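(* Let $d \in \{2,3\}$ and assume that $\psi \colon \mathbb{R}^d \to \mathbb{R}_\infty$ is convex, lower semicontinuous and satisfies $$\psi(e(\nu)) = \psi(e(\operatorname{diag}(\epsilon)\nu)) \quad\text{for all } \nu\in\mathbb{R}^d \text{ and all } \epsilon\in\{-1,1\}^d \text{ with } \prod_{i=1}^d\epsilon_i=1 .$$ Then the function $\Phi\colon\mathbb{R}^d\to\mathbb{R}_\infty$ given by $\Phi(\nu)=\psi(e(\nu))$ is lower semicontinuous signed singular value polyconvex.
   Context: $\mathbb{R}_\infty := \mathbb{R}\cup\{\infty\}$. $\operatorname{diag}(\nu)$ is the diagonal matrix with entries $\nu_1,\dots,\nu_d$. The map $e\colon\mathbb{R}^d\to\mathbb{R}^d$ of elementary symmetric polynomials is $e(x)=(x_1+x_2,\;x_1x_2)$ for $d=2$ and $e(x)=(x_1+x_2+x_3,\;x_2x_3+x_1x_3+x_1x_2,\;x_1x_2x_3)$ for $d=3$. $\Pi(d) := \{S\operatorname{diag}(\epsilon) \mid S \text{ a } d\times d \text{ permutation matrix},\ \epsilon\in\{-1,1\}^d,\ \prod_i\epsilon_i=1\}$; $\Phi\colon\mathbb{R}^d\to\mathbb{R}_\infty$ is $\Pi(d)$-invariant if $\Phi(S\nu)=\Phi(\nu)$ for all $\nu\in\mathbb{R}^d$, $S\in\Pi(d)$. Every $F\in\mathbb{R}^{d\times d}$ can be written $F=R_1\operatorname{diag}(\nu)R_2$ with $R_1,R_2\in\mathrm{SO}(d)$, $\nu\in\mathbb{R}^d$; any such $\nu$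 is called (a choice of) signed singular values of $F$, and it is unique up to the action of $\Pi(d)$. Hence a $\Pi(d)$-invariant $\Phi$ determines a function $W\colon\mathbb{R}^{d\times d}\to\mathbb{R}_\infty$ by $W(F):=\Phi(\nu_F)$, with $\nu_F$ any signed singular values of $F$. A $\Pi(d)$-invariant $\Phi$ is called lower semicontinuous signed singular value polyconvex if this $W$ is lower semicontinuous polyconvex, i.e. there is a lower semicontinuous convex $G\colon\mathbb{R}^{K_d}\to\mathbb{R}_\infty$ with $W(F)=G(\mathcal{M}(F))$ for all $F$, where $\mathcal{M}(F)$ is the vector of all minors of $F$: $\mathcal{M}(F)=(F,\det F)\in\mathbb{R}^5$ ($K_2=5$) for $d=2$, and $\mathcal{M}(F)=(F,\operatorname{adj}(F)^\top,\det F)\in\mathbb{R}^{19}$ ($K_3=19$) for $d=3$. *)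

theory Defs
  imports "HOL-Analysis.Analysis"
begin

(* The codomain R \<union> {\<infinity>}, as a set of extended reals. *)
definition Rinf :: "ereal set" where
  "Rinf = {r. r \<noteq> -\<infinity>}"

(* Intended for functions with values in Rinf only: ereal arithmetic sets \<infinity> + (-\<infinity>) = \<infinity>. *)
definition convex_ext :: "('a::real_vector \<Rightarrow> ereal) \<Rightarrow> bool" where
  "convex_ext f \<longleftrightarrow>
     (\<forall>x y t. 0 < t \<and> t < 1 \<longrightarrow>
        f ((1 - t) *\<^sub>R x + t *\<^sub>R y) \<le> ereal (1 - t) * f x + ereal t * f y)"

definition lower_semicontinuous :: "('a::topological_space \<Rightarrow> ereal) \<Rightarrow> bool" where
  "lower_semicontinuous f \<longleftrightarrow> (\<forall>x. f x \<le> Liminf (at x) f)"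

definition diag :: "real^'n \<Rightarrow> real^'n^'n" where
  "diag v = (\<chi> i j. if i = j then v $ i else 0)"

definition even_signs :: "(real^'n) set" where
  "even_signs = {\<epsilon>. (\<forall>i. \<epsilon> $ i \<in> {-1, 1}) \<and> (\<Prod>i\<in>UNIV. \<epsilon> $ i) = 1}"

definition permutation_matrix :: "real^'n^'n \<Rightarrow> bool" where
  "permutation_matrix S \<longleftrightarrow>
     (\<exists>p. p permutes UNIV \<and> S = (\<chi> i j. if i = p j then 1 else 0))"

definition signed_perms :: "(real^'n^'n) set" where
  "signed_perms = {S ** diag \<epsilon> | S \<epsilon>. permutation_matrix S \<and> \<epsilon> \<in> even_signs}"

definition signed_perm_invariant :: "(real^'n \<Rightarrow> ereal) \<Rightarrow> bool" where
  "signed_perm_invariant \<Phi> \<longleftrightarrow> (\<forall>\<nu>. \<forall>S\<in>signed_perms. \<Phi> (S *v \<nu>) = \<Phi> \<nu>)"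

definition signed_singular_values :: "real^'n^'n \<Rightarrow> real^'n \<Rightarrow> bool" where
  "signed_singular_values F \<nu> \<longleftrightarrow>
     (\<exists>R1 R2. rotation_matrix R1 \<and> rotation_matrix R2 \<and> F = R1 ** diag \<nu> ** R2)"

(* Every F has signed singular values, unique up to signed_perms, so the choice made here is
   immaterial for invariant \<Phi>. *)
definition ssv_matrix_function :: "(real^'n \<Rightarrow> ereal) \<Rightarrow> real^'n^'n \<Rightarrow> ereal" where
  "ssv_matrix_function \<Phi> F = \<Phi> (SOME \<nu>. signed_singular_values F \<nu>)"

(* The (i,j) cofactor: replacing row i and column j by unit vectors gives
   (-1)^(i+j) times the minor with row i and column j deleted. *)
definition cofactor_matrix :: "real^'n^'n \<Rightarrow> real^'n^'n" where
  "cofactor_matrix F = (\<chi> i j. det (\<chi> k l.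
     if k = i \<and> l = j then 1 else if k = i \<or> l = j then 0 else F $ k $ l))"

definition adjugate :: "real^'n^'n \<Rightarrow> real^'n^'n" where
  "adjugate F = transpose (cofactor_matrix F)"

lemma adjugate_mult_3:
  fixes F :: "real^3^3"
  shows "F ** adjugate F = mat (det F)"
  by (simp add: vec_eq_iff forall_3 matrix_matrix_mult_def adjugate_def cofactor_matrix_def
      transpose_def mat_def det_3 sum_3 algebra_simps)

(* The product types play the roles of R^5 and R^19. *)
definition minors2 :: "real^2^2 \<Rightarrow> (real^2^2) \<times> real" where
  "minors2 F = (F, det F)"

definition minors3 :: "real^3^3 \<Rightarrow> (real^3^3) \<times> (real^3^3) \<times> real" where
  "minors3 F = (F, transpose (adjugate F), det F)"

(* The parameter M is the map sending a matrix to the vector of all its minors: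
   minors2 or minors3, according to the dimension. *)
definition lsc_polyconvex ::
    "(real^'n^'n \<Rightarrow> 'm::euclidean_space) \<Rightarrow> (real^'n^'n \<Rightarrow> ereal) \<Rightarrow> bool" where
  "lsc_polyconvex M W \<longleftrightarrow>
     (\<exists>G. range G \<subseteq> Rinf \<and> convex_ext G \<and> lower_semicontinuous G \<and> (\<forall>F. W F = G (M F)))"

definition lsc_ssv_polyconvex ::
    "(real^'n^'n \<Rightarrow> 'm::euclidean_space) \<Rightarrow> (real^'n \<Rightarrow> ereal) \<Rightarrow> bool" where
  "lsc_ssv_polyconvex M \<Phi> \<longleftrightarrow>
     range \<Phi> \<subseteq> Rinf \<and> signed_perm_invariant \<Phi> \<and> lsc_polyconvex M (ssv_matrix_function \<Phi>)"

definition esym2 :: "real^2 \<Rightarrow> real^2" where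
  "esym2 x = vector [x$1 + x$2, x$1 * x$2]"

definition esym3 :: "real^3 \<Rightarrow> real^3" where
  "esym3 x = vector [x$1 + x$2 + x$3, x$2 * x$3 + x$1 * x$3 + x$1 * x$2, x$1 * x$2 * x$3]"

end

(* The convex extension of W to the vector of minors is
   G(F, A, delta) = sup over rotations Q of psi(tr(Q F), tr(Q A), delta).
   For F = R1 diag(nu) R2 the rotation Q = R2^T R1^T attains psi(e(nu)). For an
   arbitrary Q, cyclic invariance of the trace and cof(R F) = R cof(F) turn the argument
   of psi into (sum r_ii nu_i, sum r_ii nu_j nu_k, det F) for a rotation R. The
   diagonal of a rotation is a convex combination of even sign vectors (in dimension 3 because
   every rotation has trace at least -1), so the argument is a convex combination of points
   e(diag(eps) nu), at all of which psi has the value psi(e(nu)). *)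

theory Submission
  imports Defs
begin

section \<open>Extended-valued convex and lower semicontinuous functions\<close>

text \<open>The bound \<open>c < f x\<close> holds at \<open>x\<close> itself, so the punctured
  filter in \<open>Liminf\<close> can be replaced by full neighbourhoods, which pull back along
  continuous maps.\<close>

lemma lower_semicontinuous_iff_nhds:
  "lower_semicontinuous f \<longleftrightarrow> (\<forall>x. \<forall>c<f x. eventually (\<lambda>y. c < f y) (nhds x))"
  unfolding lower_semicontinuous_def le_Liminf_iff by (auto simp: eventually_nhds_conv_at)

lemma lower_semicontinuous_compose:
  assumes "lower_semicontinuous f" "\<And>x. isCont L x"
  shows "lower_semicontinuous (\<lambda>x. f (L x))"
  unfolding lower_semicontinuous_iff_nhds
proof (intro allI impI)
  fix x c assume "c < f (L x)"
  then have "eventually (\<lambda>y. c < f y) (nhds (L x))"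
    using assms(1) by (simp add: lower_semicontinuous_iff_nhds)
  moreover have "filterlim L (nhds (L x)) (nhds x)"
    using assms(2)[of x] by (simp add: isCont_def tendsto_at_iff_tendsto_nhds)
  ultimately show "eventually (\<lambda>y. c < f (L y)) (nhds x)"
    by (rule eventually_compose_filterlim)
qed

lemma lower_semicontinuous_SUP:
  assumes "\<And>i. i \<in> I \<Longrightarrow> lower_semicontinuous (f i)"
  shows "lower_semicontinuous (\<lambda>x. SUP i\<in>I. f i x)"
  unfolding lower_semicontinuous_iff_nhds
proof (intro allI impI)
  fix x c assume "c < (SUP i\<in>I. f i x)"
  then obtain i where i: "i \<in> I" "c < f i x"
    by (auto simp: less_SUP_iff)
  then have "eventually (\<lambda>y. c < f i y) (nhds x)"
    using assms by (simp add: lower_semicontinuous_iff_nhds)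
  then show "eventually (\<lambda>y. c < (SUP i\<in>I. f i y)) (nhds x)"
    by eventually_elim (use i in \<open>auto simp: less_SUP_iff\<close>)
qed

lemma convex_ext_compose_linear:
  assumes "convex_ext f" "linear L"
  shows "convex_ext (\<lambda>x. f (L x))"
  using assms by (simp add: convex_ext_def linear_add linear_scale)

lemma convex_ext_SUP:
  assumes "\<And>i. i \<in> I \<Longrightarrow> convex_ext (f i)"
  shows "convex_ext (\<lambda>x. SUP i\<in>I. f i x)"
  unfolding convex_ext_def
proof (intro allI impI SUP_least)
  fix x y i and t :: real
  assume t: "0 < t \<and> t < 1" and i: "i \<in> I"
  have "f i ((1 - t) *\<^sub>R x + t *\<^sub>R y) \<le> ereal (1 - t) * f i x + ereal t * f i y"
    using assms[OF i] t by (simp add: convex_ext_def)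
  also have "\<dots> \<le> ereal (1 - t) * (SUP i\<in>I. f i x) + ereal t * (SUP i\<in>I. f i y)"
    using t i by (intro add_mono ereal_mult_left_mono SUP_upper) auto
  finally show "f i ((1 - t) *\<^sub>R x + t *\<^sub>R y)
      \<le> ereal (1 - t) * (SUP i\<in>I. f i x) + ereal t * (SUP i\<in>I. f i y)" .
qed

text \<open>Serves as Jensen's inequality for points sharing a bound \<open>c\<close>, without sums
  of several extended reals. The level may be infinite.\<close>

lemma convex_sublevel_convex_ext:
  assumes "convex_ext f"
  shows "convex {x. f x \<le> c}"
  unfolding convex_alt
proof (intro ballI allI impI)
  fix x y and t :: real
  assume xy: "x \<in> {x. f x \<le> c}" "y \<in> {x. f x \<le> c}" and t: "0 \<le> t \<and> t \<le> 1"
  show "(1 - t) *\<^sub>R x + t *\<^sub>R y \<in> {x. f x \<le> c}"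
  proof (cases "t = 0 \<or> t = 1")
    case True
    then show ?thesis using xy by auto
  next
    case False
    then have t: "0 < t" "t < 1" using t by auto
    have "f ((1 - t) *\<^sub>R x + t *\<^sub>R y) \<le> ereal (1 - t) * f x + ereal t * f y"
      using assms t by (simp add: convex_ext_def)
    also have "\<dots> \<le> ereal (1 - t) * c + ereal t * c"
      using t xy by (intro add_mono ereal_mult_left_mono) auto
    also have "\<dots> = c"
      using t by (cases c) (auto simp: algebra_simps)
    finally show ?thesis by simp
  qed
qed

text \<open>Composition with linear maps and suprema preserve convexity and lower semicontinuity;
  \<open>I\<close> being nonempty keeps the supremum above \<open>-\<infinity>\<close>.\<close>

lemma lsc_polyconvexI:
  fixes \<psi> :: "'b::real_normed_vector \<Rightarrow> ereal" and M :: "real^'n^'n \<Rightarrow> 'm::euclidean_space"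
  assumes \<psi>: "range \<psi> \<subseteq> Rinf" "convex_ext \<psi>" "lower_semicontinuous \<psi>"
    and L: "\<And>i. i \<in> I \<Longrightarrow> linear (L i)" and "I \<noteq> {}"
    and W: "\<And>F. W F = (SUP i\<in>I. \<psi> (L i (M F)))"
  shows "lsc_polyconvex M W"
  unfolding lsc_polyconvex_def
proof (intro exI conjI allI)
  let ?G = "\<lambda>z. SUP i\<in>I. \<psi> (L i z)"
  obtain j where j: "j \<in> I" using \<open>I \<noteq> {}\<close> by auto
  show "range ?G \<subseteq> Rinf"
  proof safe
    fix z
    have "-\<infinity> < \<psi> (L j z)" using \<psi>(1) by (auto simp: Rinf_def)
    also have "\<dots> \<le> ?G z" using j by (rule SUP_upper)
    finally show "?G z \<in> Rinf" by (simp add: Rinf_def)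
  qed
  show "convex_ext ?G"
    by (rule convex_ext_SUP) (rule convex_ext_compose_linear[OF \<psi>(2) L])
  show "lower_semicontinuous ?G"
  proof (rule lower_semicontinuous_SUP, rule lower_semicontinuous_compose[OF \<psi>(3)])
    show "isCont (L i) x" if "i \<in> I" for i x
      using L[OF that] by (simp add: linear_conv_bounded_linear linear_continuous_at)
  qed
  show "W F = ?G (M F)" for F by (rule W)
qed

section \<open>Existence of signed singular values\<close>

lemma rotation_matrix_mat_1: "rotation_matrix (mat 1 :: real^'n^'n)"
  by (simp add: rotation_matrix_def orthogonal_matrix_def transpose_mat)

lemma rotation_matrix_mul:
  fixes A B :: "real^'n^'n"
  assumes "rotation_matrix A" "rotation_matrix B"
  shows "rotation_matrix (A ** B)"
  using assms by (simp add: rotation_matrix_def orthogonal_matrix_mul det_mul)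

lemma rotation_matrix_transpose:
  fixes A :: "real^'n^'n"
  assumes "rotation_matrix A"
  shows "rotation_matrix (transpose A)"
  using assms by (auto simp: rotation_matrix_def orthogonal_matrix_def)

text \<open>The rows are unit vectors, and orthogonality and determinant 1 are equations between
  continuous functions of the entries.\<close>

lemma compact_rotation_matrices: "compact {Q :: real^'n^'n. rotation_matrix Q}"
proof -
  have "bounded {Q :: real^'n^'n. rotation_matrix Q}"
    unfolding bounded_iff
  proof (intro exI ballI)
    fix Q :: "real^'n^'n" assume "Q \<in> {Q. rotation_matrix Q}"
    then have Q: "Q ** transpose Q = mat 1"
      by (simp add: rotation_matrix_def orthogonal_matrix_def)
    have "norm (Q $ i) = 1" for i
    proof -
      have "inner (Q $ i) (Q $ i) = (Q ** transpose Q) $ i $ i"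
        by (simp add: matrix_matrix_mult_def transpose_def inner_vec_def)
      then show ?thesis by (simp add: Q mat_def norm_eq_1)
    qed
    moreover have "norm Q \<le> (\<Sum>i\<in>UNIV. norm (Q $ i))"
      unfolding norm_vec_def by (rule L2_set_le_sum) simp
    ultimately show "norm Q \<le> real CARD('n)" by simp
  qed
  moreover have "closed {Q :: real^'n^'n. rotation_matrix Q}"
    unfolding rotation_matrix_def orthogonal_matrix det_def matrix_matrix_mult_def transpose_def
    by (intro closed_Collect_conj closed_Collect_eq continuous_intros)
  ultimately show ?thesis by (simp add: compact_eq_bounded_closed)
qed

section \<open>Plane rotations\<close>

text \<open>For \<open>i \<noteq> j\<close>, the rotation by \<open>t\<close> in the plane of
  coordinates \<open>i\<close> and \<open>j\<close>. The two special rows are written as sums of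
  one-entry terms, so that the sums in matrix products collapse.\<close>

definition givens :: "'n \<Rightarrow> 'n \<Rightarrow> real \<Rightarrow> real^'n^'n" where
  "givens i j t = (\<chi> a b.
     if a = i then (if b = i then cos t else 0) - (if b = j then sin t else 0)
     else if a = j then (if b = i then sin t else 0) + (if b = j then cos t else 0)
     else if b = a then 1 else 0)"

lemma givens_nth:
  "givens i j t $ a $ b =
     (if a = i then (if b = i then cos t else 0) - (if b = j then sin t else 0)
      else if a = j then (if b = i then sin t else 0) + (if b = j then cos t else 0)
      else if b = a then 1 else 0)"
  by (simp add: givens_def)

lemma givens_mult_left:
  assumes "i \<noteq> j"
  shows "(givens i j t ** M) $ a $ b =
    (if a = i then cos t * M $ i $ b - sin t * M $ j $ b
     else if a = j then sin t * M $ i $ b + cos t * M $ j $ b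
     else M $ a $ b)"
  using assms
  by (simp add: givens_nth matrix_matrix_mult_def algebra_simps sum_subtractf sum.distrib
      if_distrib[of "\<lambda>x. x * _"] if_distrib[of "\<lambda>x. _ * x"] cong: if_cong)

lemma givens_mult_right:
  assumes "i \<noteq> j"
  shows "(M ** givens i j t) $ a $ b =
    (if b = i then cos t * M $ a $ i + sin t * M $ a $ j
     else if b = j then cos t * M $ a $ j - sin t * M $ a $ i
     else M $ a $ b)"
proof -
  \<comment> \<open>The same entries sorted by column, since the product now sums over the row
    index.\<close>
  have "givens i j t $ c $ b =
     (if b = i then (if c = i then cos t else 0) + (if c = j then sin t else 0)
     else if b = j then (if c = j then cos t else 0) - (if c = i then sin t else 0)
     else if c = b then 1 else 0)" for c
    using assms by (auto simp: givens_nth)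
  then show ?thesis
    by (simp add: matrix_matrix_mult_def algebra_simps sum_subtractf sum.distrib
      if_distrib[of "\<lambda>x. x * _"] if_distrib[of "\<lambda>x. _ * x"] cong: if_cong)
qed

lemma givens_add:
  assumes "i \<noteq> j"
  shows "givens i j s ** givens i j t = givens i j (s + t)"
  using assms
  by (auto simp: vec_eq_iff givens_mult_left givens_nth cos_add sin_add algebra_simps)

text \<open>Transposition negates the angle, so \<open>givens_add\<close> gives orthogonality.
  Halving the angle exhibits the determinant, which is 1 or -1, as a square.\<close>

lemma rotation_matrix_givens:
  assumes "i \<noteq> j"
  shows "rotation_matrix (givens i j t)"
proof -
  have "transpose (givens i j t) = givens i j (- t)" for t
    using assms by (auto simp: vec_eq_iff givens_nth transpose_def)
  moreover have "givens i j 0 = mat 1"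
    by (auto simp: vec_eq_iff givens_nth mat_def)
  ultimately have orth: "orthogonal_matrix (givens i j t)" for t
    using givens_add[OF assms, of "-t" t] by (simp add: orthogonal_matrix)
  have "det (givens i j t) = (det (givens i j (t / 2)))\<^sup>2"
    using givens_add[OF assms, of "t/2" "t/2"] by (metis det_mul field_sum_of_halves power2_eq_square)
  then have "det (givens i j t) \<ge> 0" by simp
  then show ?thesis
    using orth[of t] det_orthogonal_matrix[of "givens i j t"] by (auto simp: rotation_matrix_def)
qed

text \<open>\<open>A * cos t - B * sin t\<close> is the first coordinate of \<open>(A, B)\<close>
  rotated by \<open>t\<close>; the angle is chosen to turn this vector onto the first axis.\<close>

lemma exists_angle_square_eq: "\<exists>t. (A * cos t - B * sin t)\<^sup>2 = A\<^sup>2 + (B::real)\<^sup>2"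
proof (cases "A\<^sup>2 + B\<^sup>2 = 0")
  case True
  then show ?thesis by simp
next
  case False
  define r where "r = sqrt (A\<^sup>2 + B\<^sup>2)"
  have r: "r\<^sup>2 = A\<^sup>2 + B\<^sup>2" "r \<noteq> 0"
    using False by (auto simp: r_def)
  have "(A / r)\<^sup>2 + (- B / r)\<^sup>2 = (A\<^sup>2 + B\<^sup>2) / r\<^sup>2"
    by (simp add: power_divide add_divide_distrib)
  then have "(A / r)\<^sup>2 + (- B / r)\<^sup>2 = 1"
    using r False by simp
  then obtain t where "A / r = cos t" "- B / r = sin t"
    using sincos_total_2pi by blast
  then have "A * cos t - B * sin t = (A\<^sup>2 + B\<^sup>2) / r"
    by (simp add: power2_eq_square add_divide_distrib flip: \<open>A / r = cos t\<close> \<open>- B / r = sin t\<close>)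
  also have "\<dots> = r"
    unfolding r(1)[symmetric] by (simp add: power2_eq_square)
  finally have "(A * cos t - B * sin t)\<^sup>2 = A\<^sup>2 + B\<^sup>2"
    using r(1) by simp
  then show ?thesis ..
qed

text \<open>In terms of the conformal part \<open>(a + d, c - b)\<close> and the anticonformal part
  \<open>(a - d, b + c)\<close> of the matrix, rotating from the left by \<open>s\<close> and from the right by \<open>t\<close>
  rotates these by \<open>s + t\<close> and \<open>s - t\<close>, so they can be made real independently.\<close>

lemma exists_rotations_diag_squares:
  fixes a b c d :: real
  shows "\<exists>s t.
    (cos t * (cos s * a - sin s * c) + sin t * (cos s * b - sin s * d))\<^sup>2 +
    (cos t * (sin s * b + cos s * d) - sin t * (sin s * a + cos s * c))\<^sup>2
    = a\<^sup>2 + b\<^sup>2 + c\<^sup>2 + d\<^sup>2"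
proof -
  obtain \<alpha> where \<alpha>: "((a + d) * cos \<alpha> - (c - b) * sin \<alpha>)\<^sup>2 = (a + d)\<^sup>2 + (c - b)\<^sup>2"
    using exists_angle_square_eq by blast
  obtain \<beta> where \<beta>: "((a - d) * cos \<beta> - (b + c) * sin \<beta>)\<^sup>2 = (a - d)\<^sup>2 + (b + c)\<^sup>2"
    using exists_angle_square_eq by blast
  define s t where "s = (\<alpha> + \<beta>) / 2" and "t = (\<alpha> - \<beta>) / 2"
  have st: "\<alpha> = s + t" "\<beta> = s - t"
    by (simp_all add: s_def t_def field_simps)
  \<comment> \<open>These are the new diagonal entries. Their sum and difference are the first
    coordinates of the rotated conformal and anticonformal parts, and the parallelogram identity
    then yields \<open>p\<^sup>2 + q\<^sup>2\<close>.\<close>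
  define p q where "p = cos t * (cos s * a - sin s * c) + sin t * (cos s * b - sin s * d)"
    and "q = cos t * (sin s * b + cos s * d) - sin t * (sin s * a + cos s * c)"
  have "p + q = (a + d) * cos \<alpha> - (c - b) * sin \<alpha>" "p - q = (a - d) * cos \<beta> - (b + c) * sin \<beta>"
    by (simp_all add: st p_def q_def cos_add sin_add cos_diff sin_diff algebra_simps)
  then have "(p + q)\<^sup>2 + (p - q)\<^sup>2 = (a + d)\<^sup>2 + (c - b)\<^sup>2 + (a - d)\<^sup>2 + (b + c)\<^sup>2"
    using \<alpha> \<beta> by simp
  then have "p\<^sup>2 + q\<^sup>2 = a\<^sup>2 + b\<^sup>2 + c\<^sup>2 + d\<^sup>2"
    by (simp add: power2_eq_square algebra_simps)
  then show ?thesis unfolding p_def q_def by blast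
qed

text \<open>A variational Jacobi method: among all \<open>A ** F ** B\<close> with rotations \<open>A\<close> and \<open>B\<close>, one
  maximising the sum of the squared diagonal entries is diagonal, since otherwise rotating in a
  coordinate plane moves the weight of an off-diagonal entry to the diagonal.\<close>

lemma signed_singular_values_exist:
  fixes F :: "real^'n^'n"
  shows "\<exists>\<nu>. signed_singular_values F \<nu>"
proof -
  define K where "K = {Q :: real^'n^'n. rotation_matrix Q}"
  define f where "f = (\<lambda>M :: real^'n^'n. \<Sum>k\<in>UNIV. (M $ k $ k)\<^sup>2)"
  have "compact (K \<times> K)" "K \<times> K \<noteq> {}"
    using compact_rotation_matrices rotation_matrix_mat_1 by (auto simp: K_def intro: compact_Times)
  moreover have "continuous_on (K \<times> K) (\<lambda>z. f (fst z ** F ** snd z))"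
    unfolding f_def matrix_matrix_mult_def by (simp, intro continuous_intros)
  ultimately obtain z where z: "z \<in> K \<times> K"
    and zmax: "\<And>w. w \<in> K \<times> K \<Longrightarrow> f (fst w ** F ** snd w) \<le> f (fst z ** F ** snd z)"
    by (metis (no_types, lifting) continuous_attains_sup)
  obtain A B where AB: "rotation_matrix A" "rotation_matrix B" and zAB: "z = (A, B)"
    using z by (auto simp: K_def)
  define M where "M = A ** F ** B"
  \<comment> \<open>Products of rotations are rotations, so \<open>P ** M ** Q\<close> is still of
    the form over which \<open>M\<close> is maximal.\<close>
  have Mmax: "f (P ** M ** Q) \<le> f M" if "rotation_matrix P" "rotation_matrix Q" for P Q
    using zmax[of "(P ** A, B ** Q)"] that AB
    by (simp add: K_def zAB M_def rotation_matrix_mul matrix_mul_assoc)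
  have offdiag: "M $ i $ j = 0" if ij: "i \<noteq> j" for i j
  proof -
    obtain s t where st:
      "(cos t * (cos s * M $ i $ i - sin s * M $ j $ i) + sin t * (cos s * M $ i $ j - sin s * M $ j $ j))\<^sup>2 +
       (cos t * (sin s * M $ i $ j + cos s * M $ j $ j) - sin t * (sin s * M $ i $ i + cos s * M $ j $ i))\<^sup>2
       = (M $ i $ i)\<^sup>2 + (M $ i $ j)\<^sup>2 + (M $ j $ i)\<^sup>2 + (M $ j $ j)\<^sup>2"
      using exists_rotations_diag_squares by blast
    define N where "N = givens i j s ** M ** givens i j t"
    have split: "f X = (X $ i $ i)\<^sup>2 + (X $ j $ j)\<^sup>2 + (\<Sum>k\<in>UNIV - {i, j}. (X $ k $ k)\<^sup>2)" for X
      unfolding f_def using ij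
      by (subst sum.subset_diff[of "{i, j}"]) auto
    \<comment> \<open>Only rows and columns \<open>i\<close> and \<open>j\<close> change, so the
      other diagonal entries survive.\<close>
    have "(\<Sum>k\<in>UNIV - {i, j}. (N $ k $ k)\<^sup>2) = (\<Sum>k\<in>UNIV - {i, j}. (M $ k $ k)\<^sup>2)"
      using ij by (intro sum.cong) (auto simp: N_def givens_mult_left givens_mult_right)
    moreover have "(N $ i $ i)\<^sup>2 + (N $ j $ j)\<^sup>2
        = (M $ i $ i)\<^sup>2 + (M $ i $ j)\<^sup>2 + (M $ j $ i)\<^sup>2 + (M $ j $ j)\<^sup>2"
      using ij st by (simp add: N_def givens_mult_left givens_mult_right)
    moreover have "f N \<le> f M"
      using Mmax ij by (simp add: N_def rotation_matrix_givens)
    ultimately have "(M $ i $ j)\<^sup>2 + (M $ j $ i)\<^sup>2 \<le> 0"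
      by (simp add: split)
    then show ?thesis by (simp add: sum_power2_le_zero_iff)
  qed
  have "diag (\<chi> k. M $ k $ k) = M"
    using offdiag by (auto simp: diag_def vec_eq_iff)
  moreover have "F = transpose A ** M ** transpose B"
  proof -
    have "transpose A ** M ** transpose B = (transpose A ** A) ** F ** (B ** transpose B)"
      by (simp add: M_def matrix_mul_assoc)
    also have "\<dots> = F"
      using AB by (simp add: rotation_matrix_def orthogonal_matrix_def)
    finally show ?thesis by simp
  qed
  ultimately show ?thesis
    unfolding signed_singular_values_def
    using rotation_matrix_transpose AB by metis
qed

text \<open>Replaces the choice operator by some \<open>\<nu>\<close> that comes with a
  factorisation of \<open>F\<close>.\<close>

lemma ssv_matrix_functionE:
  obtains \<nu> where "signed_singular_values F \<nu>" "ssv_matrix_function \<Phi> F = \<Phi> \<nu>"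
  using someI_ex[OF signed_singular_values_exist[of F]] unfolding ssv_matrix_function_def by blast

section \<open>Diagonals of rotations\<close>

lemma trace_mult_diag: "trace (R ** diag \<nu>) = (\<Sum>i\<in>UNIV. R $ i $ i * \<nu> $ i)"
  by (simp add: trace_def matrix_matrix_mult_def diag_def if_distrib[of "\<lambda>x. _ * x"] cong: if_cong)

lemma rotation_matrix_2_diagonal:
  fixes R :: "real^2^2"
  assumes "rotation_matrix R"
  shows "R $ 2 $ 2 = R $ 1 $ 1" "\<bar>R $ 1 $ 1\<bar> \<le> 1"
proof -
  have "transpose R ** R = mat 1" "det R = 1"
    using assms by (auto simp: rotation_matrix_def orthogonal_matrix_def)
  then have R: "(R $ 1 $ 1)\<^sup>2 + (R $ 2 $ 1)\<^sup>2 = 1" "(R $ 1 $ 2)\<^sup>2 + (R $ 2 $ 2)\<^sup>2 = 1"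
    "R $ 1 $ 1 * R $ 2 $ 2 - R $ 1 $ 2 * R $ 2 $ 1 = 1"
    by (simp_all add: vec_eq_iff forall_2 matrix_matrix_mult_def transpose_def mat_def sum_2 det_2
        power2_eq_square)
  \<comment> \<open>The expansion is the sum of the squared column norms minus twice the
    determinant, \<open>1 + 1 - 2\<close>.\<close>
  then have "(R $ 2 $ 2 - R $ 1 $ 1)\<^sup>2 + (R $ 1 $ 2 + R $ 2 $ 1)\<^sup>2 = 0"
    by (simp add: power2_eq_square algebra_simps)
  then show "R $ 2 $ 2 = R $ 1 $ 1" by (simp add: sum_power2_eq_zero_iff)
  have "(R $ 1 $ 1)\<^sup>2 \<le> 1" using R(1) zero_le_power2[of "R $ 2 $ 1"] by linarith
  then show "\<bar>R $ 1 $ 1\<bar> \<le> 1" by (simp add: abs_square_le_1)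
qed

section \<open>Cofactors and traces of rotations in dimension 3\<close>

text \<open>The Cauchy-Binet formula for 2 by 2 minors, checked entrywise as a polynomial
  identity.\<close>

lemma cofactor_matrix_mul_3:
  fixes A B :: "real^3^3"
  shows "cofactor_matrix (A ** B) = cofactor_matrix A ** cofactor_matrix B"
  by (simp add: vec_eq_iff forall_3 matrix_matrix_mult_def cofactor_matrix_def det_3 sum_3)
    (simp add: algebra_simps)

text \<open>With determinant 1 the adjugate is the inverse, and the inverse of a rotation is its
  transpose.\<close>

lemma cofactor_matrix_rotation_3:
  fixes R :: "real^3^3"
  assumes "rotation_matrix R"
  shows "cofactor_matrix R = R"
proof -
  have R: "transpose R ** R = mat 1" "det R = 1"
    using assms by (auto simp: rotation_matrix_def orthogonal_matrix_def)
  have "adjugate R = (transpose R ** R) ** adjugate R"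
    by (simp add: R)
  also have "\<dots> = transpose R"
    unfolding matrix_mul_assoc[symmetric] adjugate_mult_3 R(2) by simp
  finally show ?thesis by (metis adjugate_def transpose_transpose)
qed

text \<open>\<open>(1 + trace R) * (3 - trace R)\<close> is the sum of the squares of the entries of the axial vector
  of the antisymmetric part \<open>R - transpose R\<close>.\<close>

lemma trace_rotation_3_ge:
  fixes R :: "real^3^3"
  assumes "rotation_matrix R"
  shows "trace R \<ge> -1"
proof -
  let ?a = "R $ 1 $ 1" and ?b = "R $ 2 $ 2" and ?c = "R $ 3 $ 3"
  have "transpose R ** R = mat 1"
    using assms by (auto simp: rotation_matrix_def orthogonal_matrix_def)
  then have "?a\<^sup>2 + (R $ 2 $ 1)\<^sup>2 + (R $ 3 $ 1)\<^sup>2 = 1" "(R $ 1 $ 2)\<^sup>2 + ?b\<^sup>2 + (R $ 3 $ 2)\<^sup>2 = 1"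
    "(R $ 1 $ 3)\<^sup>2 + (R $ 2 $ 3)\<^sup>2 + ?c\<^sup>2 = 1"
    by (simp_all add: vec_eq_iff forall_3 matrix_matrix_mult_def transpose_def mat_def sum_3
        power2_eq_square)
  moreover have "cofactor_matrix R $ i $ i = R $ i $ i" for i
    using cofactor_matrix_rotation_3[OF assms] by simp
  from this[of 1] this[of 2] this[of 3]
  have "?b * ?c - R $ 2 $ 3 * R $ 3 $ 2 = ?a" "?a * ?c - R $ 1 $ 3 * R $ 3 $ 1 = ?b"
    "?a * ?b - R $ 1 $ 2 * R $ 2 $ 1 = ?c"
    by (simp_all add: cofactor_matrix_def det_3)
  ultimately have "(1 + trace R) * (3 - trace R)
      = (R $ 3 $ 2 - R $ 2 $ 3)\<^sup>2 + (R $ 1 $ 3 - R $ 3 $ 1)\<^sup>2 + (R $ 2 $ 1 - R $ 1 $ 2)\<^sup>2"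
    by (simp add: trace_def sum_3 power2_eq_square algebra_simps)
  then have "(1 + trace R) * (3 - trace R) \<ge> 0" by simp
  \<comment> \<open>The factors add up to 4, so they cannot both be nonpositive.\<close>
  then show ?thesis by (auto simp: zero_le_mult_iff)
qed

section \<open>Even sign vectors\<close>

lemma prod_UNIV_2: "prod f (UNIV :: 2 set) = f 1 * f 2"
  by (simp add: UNIV_2)

lemma prod_UNIV_3: "prod f (UNIV :: 3 set) = f 1 * f 2 * f 3"
  unfolding UNIV_3 by (simp add: ac_simps)

lemma even_signs_2: "vector [-1, -1] \<in> (even_signs :: (real^2) set)"
  by (simp add: even_signs_def forall_2 prod_UNIV_2)

lemma even_signs_3:
  "vector [1, 1, 1] \<in> (even_signs :: (real^3) set)"
  "vector [1, -1, -1] \<in> (even_signs :: (real^3) set)"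
  "vector [-1, 1, -1] \<in> (even_signs :: (real^3) set)"
  "vector [-1, -1, 1] \<in> (even_signs :: (real^3) set)"
  by (simp_all add: even_signs_def forall_3 prod_UNIV_3)

text \<open>Makes \<open>R ** diag \<epsilon>\<close> a rotation along with \<open>R\<close>, so
  that the lower bound on traces applies to signed sums of the diagonal of \<open>R\<close>.\<close>

lemma rotation_matrix_diag_even_signs:
  assumes "\<epsilon> \<in> even_signs"
  shows "rotation_matrix (diag \<epsilon>)"
proof -
  have "\<epsilon> $ i * \<epsilon> $ i = 1" for i
    using assms by (auto simp: even_signs_def dest!: spec[of _ i])
  moreover have "det (diag \<epsilon>) = 1"
    using assms by (subst det_diagonal) (auto simp: even_signs_def diag_def)
  ultimately show ?thesis
    by (auto simp: rotation_matrix_def orthogonal_matrix vec_eq_iff matrix_matrix_mult_def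
        transpose_def diag_def mat_def if_distrib[of "\<lambda>x. _ * x"] cong: if_cong)
qed

lemma diag_mult_vector_nth: "(diag \<epsilon> *v \<nu>) $ i = \<epsilon> $ i * \<nu> $ i"
  by (simp add: matrix_vector_mult_def diag_def if_distrib[of "\<lambda>x. x * _"] cong: if_cong)

text \<open>The signs cancel in the product, so the result is affine in \<open>\<epsilon>\<close>
  and convex combinations can be taken over the signs.\<close>

lemma esym2_even_signs:
  assumes "\<epsilon> \<in> even_signs"
  shows "esym2 (diag \<epsilon> *v \<nu>) = vector [\<epsilon> $ 1 * \<nu> $ 1 + \<epsilon> $ 2 * \<nu> $ 2, \<nu> $ 1 * \<nu> $ 2]"
proof -
  have "\<epsilon> $ 1 * \<epsilon> $ 2 = 1" using assms by (simp add: even_signs_def prod_UNIV_2)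
  moreover have "(\<epsilon> $ 1 * \<nu> $ 1) * (\<epsilon> $ 2 * \<nu> $ 2) = (\<epsilon> $ 1 * \<epsilon> $ 2) * (\<nu> $ 1 * \<nu> $ 2)"
    by (simp only: mult_ac)
  ultimately have "(\<epsilon> $ 1 * \<nu> $ 1) * (\<epsilon> $ 2 * \<nu> $ 2) = \<nu> $ 1 * \<nu> $ 2"
    by simp
  then show ?thesis by (simp only: esym2_def diag_mult_vector_nth)
qed

text \<open>An even choice of signs in dimension 3 satisfies \<open>\<epsilon> $ j * \<epsilon> $ k = \<epsilon> $ i\<close> for distinct
  \<open>i\<close>, \<open>j\<close>, \<open>k\<close>, so it acts on \<open>\<nu>\<close> and on its \<open>2 \<times> 2\<close> minors in the same way.\<close>

lemma esym3_even_signs: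
  assumes "\<epsilon> \<in> even_signs"
  shows "esym3 (diag \<epsilon> *v \<nu>) = vector [
    \<epsilon> $ 1 * \<nu> $ 1 + \<epsilon> $ 2 * \<nu> $ 2 + \<epsilon> $ 3 * \<nu> $ 3,
    \<epsilon> $ 1 * (\<nu> $ 2 * \<nu> $ 3) + \<epsilon> $ 2 * (\<nu> $ 1 * \<nu> $ 3) + \<epsilon> $ 3 * (\<nu> $ 1 * \<nu> $ 2),
    \<nu> $ 1 * \<nu> $ 2 * \<nu> $ 3]"
proof -
  have signs: "\<epsilon> $ i = 1 \<or> \<epsilon> $ i = -1" for i
    using assms by (auto simp: even_signs_def)
  have prod: "\<epsilon> $ 1 * \<epsilon> $ 2 * \<epsilon> $ 3 = 1"
    using assms by (simp add: even_signs_def prod_UNIV_3)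
  consider "\<epsilon> $ 1 = 1" "\<epsilon> $ 2 = 1" "\<epsilon> $ 3 = 1" | "\<epsilon> $ 1 = 1" "\<epsilon> $ 2 = -1" "\<epsilon> $ 3 = -1"
    | "\<epsilon> $ 1 = -1" "\<epsilon> $ 2 = 1" "\<epsilon> $ 3 = -1" | "\<epsilon> $ 1 = -1" "\<epsilon> $ 2 = -1" "\<epsilon> $ 3 = 1"
    using signs[of 1] signs[of 2] signs[of 3] prod by fastforce
  then show ?thesis
    by cases (simp_all add: esym3_def diag_mult_vector_nth)
qed

section \<open>Signed permutation invariance\<close>

lemma permutation_matrix_mult_vector_nth:
  assumes "permutation_matrix S"
  obtains q where "q permutes UNIV" "\<And>v i. (S *v v) $ i = v $ q i"
proof -
  obtain p where p: "p permutes UNIV" and S: "S = (\<chi> i j. if i = p j then 1 else 0)"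
    using assms by (auto simp: permutation_matrix_def)
  \<comment> \<open>Column \<open>j\<close> of \<open>S\<close> has its one in row
    \<open>p j\<close>, so \<open>S\<close> permutes coordinates by the inverse of
    \<open>p\<close>.\<close>
  have "i = p j \<longleftrightarrow> j = inv p i" for i j
    using permutes_inverses[OF p] by metis
  then have "(S *v v) $ i = v $ inv p i" for v i
    by (simp add: S matrix_vector_mult_def if_distrib[of "\<lambda>x. x * _"] cong: if_cong)
  then show ?thesis using that permutes_inv[OF p] by blast
qed

lemma esym2_permutation:
  assumes "permutation_matrix S"
  shows "esym2 (S *v v) = esym2 v"
proof -
  obtain q where q: "q permutes UNIV" "\<And>v i. (S *v v) $ i = v $ q i"
    using permutation_matrix_mult_vector_nth[OF assms] by blast
  have "(\<Sum>i\<in>UNIV. v $ q i) = (\<Sum>i\<in>UNIV. v $ i)" "(\<Prod>i\<in>UNIV. v $ q i) = (\<Prod>i\<in>UNIV. v $ i)"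
    using sum.permute[OF q(1), of "($) v"] prod.permute[OF q(1), of "($) v"] by (simp_all add: o_def)
  then show ?thesis by (simp add: esym2_def q(2) sum_2 prod_UNIV_2)
qed

text \<open>Newton's identity writes the second elementary symmetric polynomial through the sums of
  entries and of their squares, which a permutation only reindexes.\<close>

lemma esym3_permutation:
  assumes "permutation_matrix S"
  shows "esym3 (S *v v) = esym3 v"
proof -
  obtain q where q: "q permutes UNIV" "\<And>v i. (S *v v) $ i = v $ q i"
    using permutation_matrix_mult_vector_nth[OF assms] by blast
  have "(\<Sum>i\<in>UNIV. v $ q i) = (\<Sum>i\<in>UNIV. v $ i)" "(\<Prod>i\<in>UNIV. v $ q i) = (\<Prod>i\<in>UNIV. v $ i)"
    "(\<Sum>i\<in>UNIV. (v $ q i)\<^sup>2) = (\<Sum>i\<in>UNIV. (v $ i)\<^sup>2)"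
    using sum.permute[OF q(1), of "($) v"] prod.permute[OF q(1), of "($) v"]
      sum.permute[OF q(1), of "\<lambda>i. (v $ i)\<^sup>2"] by (simp_all add: o_def)
  moreover have "esym3 w = vector [(\<Sum>i\<in>UNIV. w $ i),
      ((\<Sum>i\<in>UNIV. w $ i)\<^sup>2 - (\<Sum>i\<in>UNIV. (w $ i)\<^sup>2)) / 2, (\<Prod>i\<in>UNIV. w $ i)]" for w
    unfolding esym3_def vec_eq_iff forall_3
    by (simp add: sum_3 prod_UNIV_3) (simp add: power2_eq_square algebra_simps)
  ultimately show ?thesis by (simp add: q(2))
qed

lemma signed_perm_invariantI:
  assumes "\<And>\<nu> S. permutation_matrix S \<Longrightarrow> \<Phi> (S *v \<nu>) = \<Phi> \<nu>"
    and "\<And>\<nu> \<epsilon>. \<epsilon> \<in> even_signs \<Longrightarrow> \<Phi> (diag \<epsilon> *v \<nu>) = \<Phi> \<nu>"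
  shows "signed_perm_invariant \<Phi>"
  using assms unfolding signed_perm_invariant_def signed_perms_def
  by (auto simp flip: matrix_vector_mul_assoc)

section \<open>Polyconvexity\<close>

lemma SUP_eq_maximum:
  fixes f :: "'a \<Rightarrow> 'b::complete_lattice"
  assumes "j \<in> I" "f j = c" "\<And>i. i \<in> I \<Longrightarrow> f i \<le> c"
  shows "(SUP i\<in>I. f i) = c"
  using assms by (intro antisym SUP_least) (auto intro: SUP_upper)

lemma trace_rotate_conjugate:
  fixes Q R1 R2 D :: "real^'n^'n"
  shows "trace (Q ** (R1 ** D ** R2)) = trace (R2 ** Q ** R1 ** D)"
  using trace_mul_sym[of "Q ** R1 ** D" R2] by (simp add: matrix_mul_assoc)

lemma rotation_conjugate_eq_mat_1:
  fixes R1 R2 :: "real^'n^'n"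
  assumes "rotation_matrix R1" "rotation_matrix R2"
  shows "R2 ** (transpose R2 ** transpose R1) ** R1 = mat 1"
proof -
  have "R2 ** (transpose R2 ** transpose R1) ** R1 = (R2 ** transpose R2) ** (transpose R1 ** R1)"
    by (simp add: matrix_mul_assoc)
  then show ?thesis
    using assms by (simp add: rotation_matrix_def orthogonal_matrix_def)
qed

lemma esym2_polyconvex:
  fixes \<psi> :: "real^2 \<Rightarrow> ereal"
  assumes \<psi>: "range \<psi> \<subseteq> Rinf" "convex_ext \<psi>" "lower_semicontinuous \<psi>"
    and inv: "\<And>\<nu> \<epsilon>. \<epsilon> \<in> even_signs \<Longrightarrow> \<psi> (esym2 (diag \<epsilon> *v \<nu>)) = \<psi> (esym2 \<nu>)"
  shows "lsc_polyconvex minors2 (ssv_matrix_function (\<lambda>\<nu>. \<psi> (esym2 \<nu>)))"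
proof -
  define L where "L = (\<lambda>Q (z :: (real^2^2) \<times> real). vector [trace (Q ** fst z), snd z] :: real^2)"
  have lin: "linear (L Q)" for Q
    by (rule linearI) (simp_all add: L_def vec_eq_iff forall_2 trace_def matrix_matrix_mult_def sum_2
        algebra_simps)
  have upper: "\<psi> (vector [trace (R ** diag \<nu>), \<nu> $ 1 * \<nu> $ 2]) \<le> \<psi> (esym2 \<nu>)"
    if R: "rotation_matrix R" for R \<nu>
  proof -
    define c where "c = R $ 1 $ 1"
    have c: "R $ 2 $ 2 = c" "0 \<le> (1 - c) / 2" "(1 - c) / 2 \<le> 1"
      using rotation_matrix_2_diagonal[OF R] by (auto simp: c_def)
    let ?S = "{x. \<psi> x \<le> \<psi> (esym2 \<nu>)}" and ?m = "esym2 (diag (vector [-1, -1]) *v \<nu>)"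
    \<comment> \<open>The diagonal \<open>(c, c)\<close> of \<open>R\<close> is the combination of
      \<open>(1, 1)\<close> and \<open>(-1, -1)\<close> with weights \<open>(1 + c) / 2\<close> and
      \<open>(1 - c) / 2\<close>.\<close>
    have "(1 - (1 - c) / 2) *\<^sub>R esym2 \<nu> + ((1 - c) / 2) *\<^sub>R ?m \<in> ?S"
      using c inv[OF even_signs_2]
      by (intro convexD_alt convex_sublevel_convex_ext \<psi>(2)) auto
    also have "(1 - (1 - c) / 2) *\<^sub>R esym2 \<nu> + ((1 - c) / 2) *\<^sub>R ?m
        = vector [trace (R ** diag \<nu>), \<nu> $ 1 * \<nu> $ 2]"
      unfolding esym2_even_signs[OF even_signs_2]
      by (simp add: vec_eq_iff forall_2 esym2_def trace_mult_diag sum_2 c flip: c_def)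
        (simp add: field_simps)
    finally show ?thesis by simp
  qed
  have "ssv_matrix_function (\<lambda>\<nu>. \<psi> (esym2 \<nu>)) F
      = (SUP Q\<in>{Q. rotation_matrix Q}. \<psi> (L Q (minors2 F)))" for F
  proof -
    obtain \<nu> where ssv: "signed_singular_values F \<nu>"
      and W: "ssv_matrix_function (\<lambda>\<nu>. \<psi> (esym2 \<nu>)) F = \<psi> (esym2 \<nu>)"
      using ssv_matrix_functionE .
    obtain R1 R2 where R: "rotation_matrix R1" "rotation_matrix R2" and F: "F = R1 ** diag \<nu> ** R2"
      using ssv by (auto simp: signed_singular_values_def)
    have "det F = \<nu> $ 1 * \<nu> $ 2"
      using R by (simp add: F det_mul rotation_matrix_def) (simp add: det_2 diag_def)
    then have L: "L Q (minors2 F) = vector [trace (R2 ** Q ** R1 ** diag \<nu>), \<nu> $ 1 * \<nu> $ 2]" for Q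
      by (simp add: L_def minors2_def) (simp add: F trace_rotate_conjugate)
    show ?thesis
      unfolding W
    proof (rule SUP_eq_maximum[symmetric])
      show "transpose R2 ** transpose R1 \<in> {Q. rotation_matrix Q}"
        using R by (simp add: rotation_matrix_mul rotation_matrix_transpose)
      show "\<psi> (L (transpose R2 ** transpose R1) (minors2 F)) = \<psi> (esym2 \<nu>)"
        unfolding L rotation_conjugate_eq_mat_1[OF R]
        by (simp add: trace_def sum_2 diag_def esym2_def)
      show "\<psi> (L Q (minors2 F)) \<le> \<psi> (esym2 \<nu>)" if "Q \<in> {Q. rotation_matrix Q}" for Q
        unfolding L using that R by (intro upper) (simp add: rotation_matrix_mul)
    qed
  qed
  then show ?thesis
    using \<psi> lin rotation_matrix_mat_1
    by (intro lsc_polyconvexI[where \<psi> = \<psi> and L = L and I = "{Q. rotation_matrix Q}"]) auto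
qed

lemma esym3_polyconvex:
  fixes \<psi> :: "real^3 \<Rightarrow> ereal"
  assumes \<psi>: "range \<psi> \<subseteq> Rinf" "convex_ext \<psi>" "lower_semicontinuous \<psi>"
    and inv: "\<And>\<nu> \<epsilon>. \<epsilon> \<in> even_signs \<Longrightarrow> \<psi> (esym3 (diag \<epsilon> *v \<nu>)) = \<psi> (esym3 \<nu>)"
  shows "lsc_polyconvex minors3 (ssv_matrix_function (\<lambda>\<nu>. \<psi> (esym3 \<nu>)))"
proof -
  define L where "L = (\<lambda>Q (z :: (real^3^3) \<times> (real^3^3) \<times> real).
    vector [trace (Q ** fst z), trace (Q ** fst (snd z)), snd (snd z)] :: real^3)"
  have lin: "linear (L Q)" for Q
    by (rule linearI) (simp_all add: L_def vec_eq_iff forall_3 trace_def matrix_matrix_mult_def sum_3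
        algebra_simps)
  define cof :: "real^3 \<Rightarrow> real^3" where "cof \<nu> = vector [\<nu>$2 * \<nu>$3, \<nu>$1 * \<nu>$3, \<nu>$1 * \<nu>$2]" for \<nu>
  have cofactor_diag: "cofactor_matrix (diag \<nu>) = diag (cof \<nu>)" for \<nu>
    by (simp add: vec_eq_iff forall_3 cofactor_matrix_def det_3 diag_def cof_def)
  have upper: "\<psi> (vector [trace (R ** diag \<nu>), trace (R ** diag (cof \<nu>)), \<nu>$1 * \<nu>$2 * \<nu>$3])
      \<le> \<psi> (esym3 \<nu>)"
    if R: "rotation_matrix R" for R \<nu>
  proof -
    define E :: "nat \<Rightarrow> real^3" where
      "E n = [vector [1, 1, 1], vector [1, -1, -1], vector [-1, 1, -1], vector [-1, -1, 1]] ! n" for n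
    \<comment> \<open>The vectors \<open>E n\<close> are the vertices of a regular tetrahedron
      centred at 0, and \<open>w\<close> gives the barycentric coordinates of the diagonal of
      \<open>R\<close> in it: the \<open>E n\<close> sum to 0 and their outer products sum to 4
      times the identity.\<close>
    define w where "w n = (1 + trace (R ** diag (E n))) / 4" for n
    have set4: "{..<4} = {0, 1, 2, 3 :: nat}" by auto
    have E: "E n \<in> even_signs" if "n < 4" for n
      using that even_signs_3 by (auto simp: E_def less_Suc_eq numeral_eq_Suc)
    let ?S = "{x. \<psi> x \<le> \<psi> (esym3 \<nu>)}"
    have "(\<Sum>n<4. w n *\<^sub>R esym3 (diag (E n) *v \<nu>)) \<in> ?S"
    proof (rule convex_sum)
      show "(\<Sum>n<4. w n) = 1"
        by (simp add: set4 w_def E_def trace_mult_diag sum_3 field_simps)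
      \<comment> \<open>The trace bound for the rotation \<open>R ** diag (E n)\<close> is exactly
        nonnegativity of the weight.\<close>
      show "0 \<le> w n" if "n \<in> {..<4}" for n
        using trace_rotation_3_ge[OF rotation_matrix_mul[OF R rotation_matrix_diag_even_signs[OF E]], of n]
          that by (simp add: w_def)
      show "esym3 (diag (E n) *v \<nu>) \<in> ?S" if "n \<in> {..<4}" for n
        using inv[OF E] that by simp
    qed (auto intro: convex_sublevel_convex_ext \<psi>(2))
    \<comment> \<open>By \<open>esym3_even_signs\<close> the points are affine in
      \<open>E n\<close>, so averaging puts the diagonal of \<open>R\<close> in place of the
      signs.\<close>
    also have "(\<Sum>n<4. w n *\<^sub>R esym3 (diag (E n) *v \<nu>)) =
        vector [trace (R ** diag \<nu>), trace (R ** diag (cof \<nu>)), \<nu>$1 * \<nu>$2 * \<nu>$3]"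
      by (simp add: set4 E_def esym3_even_signs even_signs_3 w_def)
        (simp add: vec_eq_iff forall_3 cof_def trace_mult_diag sum_3 field_simps)
    finally show ?thesis by simp
  qed
  have "ssv_matrix_function (\<lambda>\<nu>. \<psi> (esym3 \<nu>)) F
      = (SUP Q\<in>{Q. rotation_matrix Q}. \<psi> (L Q (minors3 F)))" for F
  proof -
    obtain \<nu> where ssv: "signed_singular_values F \<nu>"
      and W: "ssv_matrix_function (\<lambda>\<nu>. \<psi> (esym3 \<nu>)) F = \<psi> (esym3 \<nu>)"
      using ssv_matrix_functionE .
    obtain R1 R2 where R: "rotation_matrix R1" "rotation_matrix R2" and F: "F = R1 ** diag \<nu> ** R2"
      using ssv by (auto simp: signed_singular_values_def)
    have "det F = \<nu> $ 1 * \<nu> $ 2 * \<nu> $ 3"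
      using R by (simp add: F det_mul rotation_matrix_def) (simp add: det_3 diag_def)
    \<comment> \<open>The cofactor matrix is multiplicative and fixes the rotations
      \<open>R1\<close> and \<open>R2\<close>.\<close>
    moreover have "transpose (adjugate F) = R1 ** diag (cof \<nu>) ** R2"
      using R by (simp add: F adjugate_def cofactor_matrix_mul_3 cofactor_diag cofactor_matrix_rotation_3)
    ultimately have L: "L Q (minors3 F) =
        vector [trace (R2 ** Q ** R1 ** diag \<nu>), trace (R2 ** Q ** R1 ** diag (cof \<nu>)),
          \<nu> $ 1 * \<nu> $ 2 * \<nu> $ 3]" for Q
      by (simp add: L_def minors3_def trace_rotate_conjugate) (simp add: F trace_rotate_conjugate)
    show ?thesis
      unfolding W
    proof (rule SUP_eq_maximum[symmetric])
      show "transpose R2 ** transpose R1 \<in> {Q. rotation_matrix Q}"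
        using R by (simp add: rotation_matrix_mul rotation_matrix_transpose)
      show "\<psi> (L (transpose R2 ** transpose R1) (minors3 F)) = \<psi> (esym3 \<nu>)"
        unfolding L rotation_conjugate_eq_mat_1[OF R]
        by (simp add: trace_def sum_3 diag_def esym3_def cof_def)
      show "\<psi> (L Q (minors3 F)) \<le> \<psi> (esym3 \<nu>)" if "Q \<in> {Q. rotation_matrix Q}" for Q
        unfolding L using that R by (intro upper) (simp add: rotation_matrix_mul)
    qed
  qed
  then show ?thesis
    using \<psi> lin rotation_matrix_mat_1
    by (intro lsc_polyconvexI[where \<psi> = \<psi> and L = L and I = "{Q. rotation_matrix Q}"]) auto
qed

theorem proposition5p2:
  shows "(\<forall>\<psi> :: real^2 \<Rightarrow> ereal.
            range \<psi> \<subseteq> Rinf \<and> convex_ext \<psi> \<and> lower_semicontinuous \<psi> \<and>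
            (\<forall>\<nu>. \<forall>\<epsilon>\<in>even_signs. \<psi> (esym2 \<nu>) = \<psi> (esym2 (diag \<epsilon> *v \<nu>)))
            \<longrightarrow> lsc_ssv_polyconvex minors2 (\<lambda>\<nu>. \<psi> (esym2 \<nu>)))
       \<and> (\<forall>\<psi> :: real^3 \<Rightarrow> ereal.
            range \<psi> \<subseteq> Rinf \<and> convex_ext \<psi> \<and> lower_semicontinuous \<psi> \<and>
            (\<forall>\<nu>. \<forall>\<epsilon>\<in>even_signs. \<psi> (esym3 \<nu>) = \<psi> (esym3 (diag \<epsilon> *v \<nu>)))
            \<longrightarrow> lsc_ssv_polyconvex minors3 (\<lambda>\<nu>. \<psi> (esym3 \<nu>)))"
proof (intro conjI allI impI; elim conjE)
  fix \<psi> :: "real^2 \<Rightarrow> ereal"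
  assume \<psi>: "range \<psi> \<subseteq> Rinf" "convex_ext \<psi>" "lower_semicontinuous \<psi>"
    and inv: "\<forall>\<nu>. \<forall>\<epsilon>\<in>even_signs. \<psi> (esym2 \<nu>) = \<psi> (esym2 (diag \<epsilon> *v \<nu>))"
  have inv': "\<psi> (esym2 (diag \<epsilon> *v \<nu>)) = \<psi> (esym2 \<nu>)" if "\<epsilon> \<in> even_signs" for \<epsilon> \<nu>
    using inv that by metis
  \<comment> \<open>Permutations leave \<open>esym2\<close> itself unchanged; the sign changes are
    covered by the hypothesis on \<open>\<psi>\<close>.\<close>
  then have "signed_perm_invariant (\<lambda>\<nu>. \<psi> (esym2 \<nu>))"
    by (intro signed_perm_invariantI) (simp_all add: esym2_permutation)
  then show "lsc_ssv_polyconvex minors2 (\<lambda>\<nu>. \<psi> (esym2 \<nu>))"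
    using \<psi> esym2_polyconvex[OF \<psi> inv'] by (auto simp: lsc_ssv_polyconvex_def)
next
  fix \<psi> :: "real^3 \<Rightarrow> ereal"
  assume \<psi>: "range \<psi> \<subseteq> Rinf" "convex_ext \<psi>" "lower_semicontinuous \<psi>"
    and inv: "\<forall>\<nu>. \<forall>\<epsilon>\<in>even_signs. \<psi> (esym3 \<nu>) = \<psi> (esym3 (diag \<epsilon> *v \<nu>))"
  have inv': "\<psi> (esym3 (diag \<epsilon> *v \<nu>)) = \<psi> (esym3 \<nu>)" if "\<epsilon> \<in> even_signs" for \<epsilon> \<nu>
    using inv that by metis
  then have "signed_perm_invariant (\<lambda>\<nu>. \<psi> (esym3 \<nu>))"
    by (intro signed_perm_invariantI) (simp_all add: esym3_permutation)
  then show "lsc_ssv_polyconvex minors3 (\<lambda>\<nu>. \<psi> (esym3 \<nu>))"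
    using \<psi> esym3_polyconvex[OF \<psi> inv'] by (auto simp: lsc_ssv_polyconvex_def)
qed

end
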